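(* Suppose that $\{X_n\mid n\in\mathbb{N}\}$ is a collection of real-valued random variables satisfying the infinite intersection property (IIP) and the decorrelation property (DCP). Then the ternary relation $\cdot\perp\!\!\!\perp_X\cdot\mid\cdot$ on $\mathcal{P}(\mathbb{N})$ corresponding to conditional independence satisfies (P5* ).
   Context: For $A\subseteq\mathbb{N}$, $X_A=(X_a)_{a\in A}$. Conditional independence: for $A,B,C\subseteq\mathbb{N}$, $X_A\perp\!\!\!\perp X_B\mid X_C$ (also written $A\perp\!\!\!\perp_X B\mid C$) means $\mathbb{P}(E_1\mid\sigma(X_C))\mathbb{P}(E_2\mid\sigma(X_C))=\mathbb{P}(E_1\cap E_2\mid\sigma(X_C))$ a.s. for all $E_1\in\sigma(X_A)$, $E_2\in\sigma(X_B)$. (IIP): for any (possibly infinite) $D\subseteq\mathbb{N}$ and any finite pairwise disjoint $A,B,C\subseteq\mathbb{N}\setminus D$, if $X_A\perp\!\!\!\perp X_B\mid (X_C,X_D)$ and $X_A\perp\!\!\!\perp X_C\mid (X_B,X_D)$, then $X_A\perp\!\!\!\perp(X_B,X_C)\mid X_D$. (DCP): for any (possibly infinite) $D\subseteq\mathbb{N}$ and any event $E\in\bigcap_n\sigma(X_D,X_n,X_{n+1},X_{n+2},\dots)$ there exists $E'\in\sigma(X_D)$ with $\mathbb{P}(E\,\Delta\,E')=0$. (P5* ): for all (possibly infinite) pairwise disjoint $X,Y,Z\subseteq\mathbb{N}$ and any partition $X=\bigcup_kX_k$ into finite subsets, if $X_k\perp\!\!\!\perp_X Y\mid Z\cup\left(\bigcup_{j\ne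 k}X_j\right)$ for all $k$, then $X\perp\!\!\!\perp_X Y\mid Z$. *)

theory Defs
  imports "HOL-Probability.Probability" "HOL-Library.Disjoint_Sets"
begin

(* The sigma-algebra on the sample space generated by the random vector
   (X a) for a in A, with values in the product space over the index set A. It is given
   as a measure space of which only the space and the measurable sets matter; for empty A
   it is the trivial sigma-algebra. *)
definition sigma_rv :: "'a measure \<Rightarrow> (nat \<Rightarrow> 'a \<Rightarrow> real) \<Rightarrow> nat set \<Rightarrow> 'a measure" where
  "sigma_rv M X A =
     vimage_algebra (space M) (\<lambda>\<omega>. \<lambda>a\<in>A. X a \<omega>) (Pi\<^sub>M A (\<lambda>_. borel))"

(* The conditional probability of an event E given a sub-sigma-algebra F is the
   conditional expectation of the indicator of E. *)
definition cond_indep ::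
    "'a measure \<Rightarrow> (nat \<Rightarrow> 'a \<Rightarrow> real) \<Rightarrow> nat set \<Rightarrow> nat set \<Rightarrow> nat set \<Rightarrow> bool" where
  "cond_indep M X A B C \<longleftrightarrow>
     (\<forall>E1\<in>sets (sigma_rv M X A). \<forall>E2\<in>sets (sigma_rv M X B).
        AE \<omega> in M.
          real_cond_exp M (sigma_rv M X C) (indicator E1) \<omega> *
          real_cond_exp M (sigma_rv M X C) (indicator E2) \<omega> =
          real_cond_exp M (sigma_rv M X C) (indicator (E1 \<inter> E2)) \<omega>)"

(* Joint vectors such as (X_C, X_D) are rendered as X indexed by the union of C and D. *)
definition IIP :: "'a measure \<Rightarrow> (nat \<Rightarrow> 'a \<Rightarrow> real) \<Rightarrow> bool" where
  "IIP M X \<longleftrightarrow>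
     (\<forall>D A B C. finite A \<and> finite B \<and> finite C \<and>
        A \<subseteq> UNIV - D \<and> B \<subseteq> UNIV - D \<and> C \<subseteq> UNIV - D \<and>
        A \<inter> B = {} \<and> A \<inter> C = {} \<and> B \<inter> C = {} \<and>
        cond_indep M X A B (C \<union> D) \<and> cond_indep M X A C (B \<union> D)
        \<longrightarrow> cond_indep M X A (B \<union> C) D)"

definition DCP :: "'a measure \<Rightarrow> (nat \<Rightarrow> 'a \<Rightarrow> real) \<Rightarrow> bool" where
  "DCP M X \<longleftrightarrow>
     (\<forall>D. \<forall>E\<in>(\<Inter>n. sets (sigma_rv M X (D \<union> {n..}))).
        \<exists>E'\<in>sets (sigma_rv M X D). measure M (sym_diff E E') = 0)"

(* The partition of X is a set P of nonempty disjoint blocks, finite or infinite in number. *)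
definition P5star :: "(nat set \<Rightarrow> nat set \<Rightarrow> nat set \<Rightarrow> bool) \<Rightarrow> bool" where
  "P5star R \<longleftrightarrow>
     (\<forall>X Y Z P. X \<inter> Y = {} \<and> X \<inter> Z = {} \<and> Y \<inter> Z = {} \<and>
        partition_on X P \<and> (\<forall>S\<in>P. finite S) \<and>
        (\<forall>S\<in>P. R S Y (Z \<union> \<Union>(P - {S})))
        \<longrightarrow> R X Y Z)"

end

(* Fix a finite part Y' of Y. Applying (IIP) repeatedly to the blocks of the partition shows that Y'
   is independent of any finite union of blocks given Z and the remaining blocks. So for an event E
   of Y' the conditional probability P(E | X, Z) does not change when finitely many blocks are
   dropped from the conditioning; hence it is measurable, up to null sets, with respect to the
   intersection of the sigma-algebras generated by Z and n, n+1, ..., and (DCP) turns it into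
   P(E | Z). Finally one passes from finite Y' to Y by a monotone class argument. *)
theory Submission
  imports Defs
begin

section \<open>General facts on conditional expectations, limits and partitions\<close>

lemma (in finite_measure_subalgebra) real_cond_exp_charact_generator:
  assumes gen: "sets F = sigma_sets (space M) G" and int: "Int_stable G"
    and G: "G \<subseteq> Pow (space M)" "space M \<in> G"
    and f: "integrable M f" and g: "integrable M g" "g \<in> borel_measurable F"
    and eq: "\<And>A. A \<in> G \<Longrightarrow> (\<integral>x\<in>A. f x \<partial>M) = (\<integral>x\<in>A. g x \<partial>M)"
  shows "AE x in M. real_cond_exp M F f x = g x"
proof (rule real_cond_exp_charact)
  have sub: "A \<in> sets M" if "A \<in> sigma_sets (space M) G" for A
    using that gen subalg by (auto simp: subalgebra_def)
  have int_set: "set_integrable M A h" if "integrable M h" "A \<in> sets M" for A and h :: "'a \<Rightarrow> real"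
    using integrable_mult_indicator[OF that(2,1)] by (simp add: set_integrable_def)
  fix A assume "A \<in> sets F"
  then have "A \<in> sigma_sets (space M) G"
    by (simp add: gen)
  \<comment> \<open>Dynkin's argument: the sets over which the integrals of \<open>f\<close> and
    \<open>g\<close> agree are closed under complements and countable disjoint unions, so testing on
    an intersection-stable generator \<open>G\<close> is enough. Below, \<open>G\<close> is once a
    family of intersections and once a directed union of sigma-algebras.\<close>
  from int G(1) this show "(\<integral>x\<in>A. f x \<partial>M) = (\<integral>x\<in>A. g x \<partial>M)"
  proof (induction rule: sigma_sets_induct_disjoint)
    case (basic A)
    then show ?case by (rule eq)
  next
    case empty
    show ?case by (simp add: set_lebesgue_integral_def)
  next
    case (compl A)
    have A: "A \<in> sets M" using compl(1) by (rule sub)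
    have diff: "(\<integral>x\<in>space M - A. h x \<partial>M) = (\<integral>x\<in>space M. h x \<partial>M) - (\<integral>x\<in>A. h x \<partial>M)"
      if h: "integrable M h" for h :: "'a \<Rightarrow> real"
    proof -
      have "(\<integral>x\<in>A \<union> (space M - A). h x \<partial>M) = (\<integral>x\<in>A. h x \<partial>M) + (\<integral>x\<in>space M - A. h x \<partial>M)"
        using A by (intro set_integral_Un int_set h) auto
      moreover have "A \<union> (space M - A) = space M"
        using sets.sets_into_space[OF A] by auto
      ultimately show ?thesis by simp
    qed
    \<comment> \<open>The integrals over the whole space agree because \<open>space M\<close>
      belongs to \<open>G\<close>; subtracting the integrals over \<open>A\<close> gives those over
      the complement.\<close>
    show ?case
      using diff[OF f] diff[OF g(1)] eq[OF G(2)] compl(2) by simp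
  next
    case (union A)
    have A: "A i \<in> sets M" for i using union(2) by (auto intro: sub)
    have disj: "A i \<inter> A j = {}" if "i \<noteq> j" for i j
      using union(1) that by (auto simp: disjoint_family_on_def)
    have "(\<integral>x\<in>(\<Union>i. A i). h x \<partial>M) = (\<Sum>i. (\<integral>x\<in>A i. h x \<partial>M))" if "integrable M h" for h :: "'a \<Rightarrow> real"
      using A disj by (intro lebesgue_integral_countable_add int_set that) auto
    with f g(1) union(3) show ?case by simp
  qed
qed (use f g in auto)

text \<open>A limit depends only on late terms. This is what makes a single limit function
  measurable for every member of a decreasing sequence of sigma-algebras.\<close>

lemma borel_measurable_lim_tail:
  fixes g :: "nat \<Rightarrow> 'a \<Rightarrow> real"
  assumes "\<And>n. k \<le> n \<Longrightarrow> g n \<in> borel_measurable N"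
  shows "(\<lambda>x. lim (\<lambda>n. g n x)) \<in> borel_measurable N"
proof -
  \<comment> \<open>Comparing convergence to each \<open>L\<close> shows that the two sequences have
    the same set of limits. Hence the values of \<open>lim\<close> coincide even at points where the
    sequence diverges and \<open>lim\<close> is an arbitrary default.\<close>
  have "(\<lambda>n. g n x) \<longlonglongrightarrow> L \<longleftrightarrow> (\<lambda>n. g (n + k) x) \<longlonglongrightarrow> L" for x L
    using LIMSEQ_ignore_initial_segment[of "\<lambda>n. g n x" L k] LIMSEQ_offset[of "\<lambda>n. g n x" k L] by blast
  then have "lim (\<lambda>n. g n x) = lim (\<lambda>n. g (n + k) x)" for x
    by (simp only: lim_def)
  then show ?thesis
    using assms by (auto intro!: borel_measurable_lim_metric)
qed

text \<open>Blocks are disjoint, so each point of \<open>K\<close> lies in at most one of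
  them.\<close>

lemma finite_blocks_meeting_finite_set:
  assumes "partition_on A P" "finite K"
  shows "finite {S \<in> P. S \<inter> K \<noteq> {}}"
proof -
  have "finite {S \<in> P. k \<in> S}" for k
  proof (cases "\<exists>S\<in>P. k \<in> S")
    case True
    then obtain S where "S \<in> P" "k \<in> S" by blast
    then have "{S \<in> P. k \<in> S} \<subseteq> {S}"
      using partition_onD2[OF assms(1)] by (auto simp: disjoint_def)
    then show ?thesis using finite_subset by blast
  next
    case False
    then have "{S \<in> P. k \<in> S} = {}" by blast
    then show ?thesis by (simp only: finite.emptyI)
  qed
  moreover have "{S \<in> P. S \<inter> K \<noteq> {}} = (\<Union>k\<in>K. {S \<in> P. k \<in> S})" by auto
  ultimately show ?thesis using assms(2) by simp
qed

section \<open>Sigma-algebras generated by subfamilies and their generators\<close>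

lemma space_sigma_rv [simp]: "space (sigma_rv M X A) = space M"
  by (simp add: sigma_rv_def)

lemma measurable_sigma_rv:
  assumes "a \<in> A"
  shows "X a \<in> borel_measurable (sigma_rv M X A)"
proof -
  have "(\<lambda>\<omega>. \<lambda>a\<in>A. X a \<omega>) \<in> measurable (sigma_rv M X A) (Pi\<^sub>M A (\<lambda>_. borel))"
    unfolding sigma_rv_def by (rule measurable_vimage_algebra1) (auto simp: space_PiM)
  from measurable_compose[OF this measurable_component_singleton[OF assms]] assms
  show ?thesis by simp
qed

lemma sets_sigma_rv_least:
  assumes "space N = space M" "\<And>a. a \<in> A \<Longrightarrow> X a \<in> borel_measurable N"
  shows "sets (sigma_rv M X A) \<subseteq> sets N"
  unfolding sigma_rv_def using assms by (intro sets_image_in_sets measurable_restrict) auto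

lemma sets_sigma_rv_mono:
  "A \<subseteq> B \<Longrightarrow> sets (sigma_rv M X A) \<subseteq> sets (sigma_rv M X B)"
  by (rule sets_sigma_rv_least) (auto intro: measurable_sigma_rv)

text \<open>By minimality of the sigma-algebra of a random vector, it is enough that every single
  coordinate is measurable for the sigma-algebra generated by \<open>G\<close>. This holds once
  \<open>G\<close> contains a whole sigma-algebra to which that coordinate belongs.\<close>

lemma sets_sigma_rv_generated:
  assumes G: "G \<subseteq> sets (sigma_rv M X A)"
    and ex: "\<And>a. a \<in> A \<Longrightarrow> \<exists>B. a \<in> B \<and> sets (sigma_rv M X B) \<subseteq> G"
  shows "sets (sigma_rv M X A) = sigma_sets (space M) G"
proof
  have Pow: "G \<subseteq> Pow (space M)"
    using G sets.space_closed[of "sigma_rv M X A"] by simp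
  let ?N = "sigma (space M) G"
  have sp: "space ?N = space M" and st: "sets ?N = sigma_sets (space M) G"
    using Pow by (simp_all add: space_measure_of)
  have "X a \<in> borel_measurable ?N" if a: "a \<in> A" for a
  proof -
    obtain B where B: "a \<in> B" "sets (sigma_rv M X B) \<subseteq> G" using ex[OF a] by blast
    then have "sets (sigma_rv M X B) \<subseteq> sets ?N" unfolding st by blast
    then have "subalgebra ?N (sigma_rv M X B)"
      by (simp only: subalgebra_def sp space_sigma_rv)
    then show ?thesis
      using measurable_sigma_rv[OF B(1)] by (rule measurable_from_subalg)
  qed
  then show "sets (sigma_rv M X A) \<subseteq> sigma_sets (space M) G"
    unfolding st[symmetric] by (intro sets_sigma_rv_least sp)
  show "sigma_sets (space M) G \<subseteq> sets (sigma_rv M X A)"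
    using sets.sigma_sets_subset[OF G] by simp
qed

text \<open>Intersecting with the whole space shows that the family of intersections contains both
  sigma-algebras, hence captures every coordinate.\<close>

lemma sets_sigma_rv_Un:
  "sets (sigma_rv M X (A \<union> B)) =
     sigma_sets (space M) {a \<inter> b |a b. a \<in> sets (sigma_rv M X A) \<and> b \<in> sets (sigma_rv M X B)}"
    (is "_ = sigma_sets _ ?G")
proof (rule sets_sigma_rv_generated)
  show "?G \<subseteq> sets (sigma_rv M X (A \<union> B))"
    using sets_sigma_rv_mono[of A "A \<union> B" M X] sets_sigma_rv_mono[of B "A \<union> B" M X]
    by (auto intro!: sets.Int)
  have top: "space M \<in> sets (sigma_rv M X C)" for C
    using sets.top[of "sigma_rv M X C"] by simp
  have "sets (sigma_rv M X A) \<subseteq> ?G"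
  proof
    fix E assume E: "E \<in> sets (sigma_rv M X A)"
    then have "E = E \<inter> space M" using sets.sets_into_space[OF E] by auto
    then show "E \<in> ?G" using E top by blast
  qed
  moreover have "sets (sigma_rv M X B) \<subseteq> ?G"
  proof
    fix E assume E: "E \<in> sets (sigma_rv M X B)"
    then have "E = space M \<inter> E" using sets.sets_into_space[OF E] by auto
    then show "E \<in> ?G" using E top by blast
  qed
  ultimately show "\<exists>C. a \<in> C \<and> sets (sigma_rv M X C) \<subseteq> ?G" if "a \<in> A \<union> B" for a
    using that by blast
qed

lemma Int_stable_sigma_rv_Int:
  "Int_stable {a \<inter> b |a b. a \<in> sets (sigma_rv M X A) \<and> b \<in> sets (sigma_rv M X B)}"
proof (rule Int_stableI, clarify)
  fix a b c d
  assume "a \<in> sets (sigma_rv M X A)" "b \<in> sets (sigma_rv M X B)"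
    "c \<in> sets (sigma_rv M X A)" "d \<in> sets (sigma_rv M X B)"
  moreover have "a \<inter> b \<inter> (c \<inter> d) = (a \<inter> c) \<inter> (b \<inter> d)" by auto
  ultimately show "\<exists>a' b'. a \<inter> b \<inter> (c \<inter> d) = a' \<inter> b' \<and>
      a' \<in> sets (sigma_rv M X A) \<and> b' \<in> sets (sigma_rv M X B)"
    by (meson sets.Int)
qed

lemma sets_sigma_rv_finite_parts:
  "sets (sigma_rv M X (Z \<union> Y)) =
     sigma_sets (space M) (\<Union>Y'\<in>{Y'. finite Y' \<and> Y' \<subseteq> Y}. sets (sigma_rv M X (Z \<union> Y')))"
    (is "_ = sigma_sets _ ?G")
proof (rule sets_sigma_rv_generated)
  show "?G \<subseteq> sets (sigma_rv M X (Z \<union> Y))"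
    by (intro UN_least sets_sigma_rv_mono) auto
  fix a assume "a \<in> Z \<union> Y"
  \<comment> \<open>The set \<open>{a} \<inter> Y\<close> is \<open>{a}\<close> or empty, so one
    witness serves both for \<open>a\<close> in \<open>Y\<close> and for \<open>a\<close> in
    \<open>Z\<close>.\<close>
  moreover have "sets (sigma_rv M X (Z \<union> ({a} \<inter> Y))) \<subseteq> ?G"
    by (rule UN_upper) auto
  ultimately show "\<exists>B. a \<in> B \<and> sets (sigma_rv M X B) \<subseteq> ?G"
    by (intro exI[of _ "Z \<union> ({a} \<inter> Y)"]) auto
qed

section \<open>Symmetry and monotonicity of conditional independence\<close>

lemma cond_indep_sym: "cond_indep M X A B C \<Longrightarrow> cond_indep M X B A C"
  unfolding cond_indep_def
proof (intro ballI)
  fix E1 E2 assume *: "\<forall>E1\<in>sets (sigma_rv M X A). \<forall>E2\<in>sets (sigma_rv M X B).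
      AE \<omega> in M. real_cond_exp M (sigma_rv M X C) (indicator E1) \<omega> *
        real_cond_exp M (sigma_rv M X C) (indicator E2) \<omega> =
        real_cond_exp M (sigma_rv M X C) (indicator (E1 \<inter> E2)) \<omega>"
    and "E1 \<in> sets (sigma_rv M X B)" "E2 \<in> sets (sigma_rv M X A)"
  then have "AE \<omega> in M. real_cond_exp M (sigma_rv M X C) (indicator E2) \<omega> *
        real_cond_exp M (sigma_rv M X C) (indicator E1) \<omega> =
        real_cond_exp M (sigma_rv M X C) (indicator (E2 \<inter> E1)) \<omega>" by blast
  then show "AE \<omega> in M. real_cond_exp M (sigma_rv M X C) (indicator E1) \<omega> *
        real_cond_exp M (sigma_rv M X C) (indicator E2) \<omega> =
        real_cond_exp M (sigma_rv M X C) (indicator (E1 \<inter> E2)) \<omega>"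
    by (simp only: mult.commute Int_commute)
qed

lemma cond_indep_subset:
  "cond_indep M X A B C \<Longrightarrow> B' \<subseteq> B \<Longrightarrow> cond_indep M X A B' C"
  unfolding cond_indep_def using sets_sigma_rv_mono[of B' B M X] by blast

section \<open>Conditional independence as equality of conditional expectations\<close>

locale real_rv_family = prob_space M for M :: "'a measure" +
  fixes X :: "nat \<Rightarrow> 'a \<Rightarrow> real"
  assumes rv [measurable]: "\<And>n. X n \<in> borel_measurable M"
begin

lemma subalgebra_sigma_rv: "subalgebra M (sigma_rv M X A)"
  unfolding subalgebra_def by (simp add: sets_sigma_rv_least[OF refl rv])

lemma finite_measure_subalgebraI:
  "subalgebra M F \<Longrightarrow> finite_measure_subalgebra M F"
  by unfold_locales

lemma sigma_rv_sets_M: "E \<in> sets (sigma_rv M X A) \<Longrightarrow> E \<in> sets M"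
  using subalgebra_sigma_rv by (auto simp: subalgebra_def)

lemma integrable_indicator_event: "E \<in> sets M \<Longrightarrow> integrable M (indicator E :: 'a \<Rightarrow> real)"
  by (simp add: emeasure_eq_measure)

lemma integrable_indicator_times:
  "E \<in> sets M \<Longrightarrow> integrable M f \<Longrightarrow> integrable M (\<lambda>x. indicator E x * (f x :: real))"
  using integrable_mult_indicator[of E M f] by simp

text \<open>Since P(E | X_C) is already measurable for the larger sigma-algebra, only its integrals
  have to be compared, and only over the generating sets c \<inter> b with c from \<open>C\<close>
  and b from \<open>B\<close>. There the product formula for E and b gives the equality.\<close>

lemma cond_exp_eq_of_cond_indep:
  assumes ci: "cond_indep M X A B C" and E: "E \<in> sets (sigma_rv M X A)"
  shows "AE x in M. real_cond_exp M (sigma_rv M X (C \<union> B)) (indicator E) x =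
                    real_cond_exp M (sigma_rv M X C) (indicator E) x"
proof -
  let ?C = "sigma_rv M X C"
  let ?h = "real_cond_exp M ?C (indicator E)"
  let ?G = "{c \<inter> b |c b. c \<in> sets ?C \<and> b \<in> sets (sigma_rv M X B)}"
  interpret C: finite_measure_subalgebra M ?C
    by (rule finite_measure_subalgebraI[OF subalgebra_sigma_rv])
  interpret CB: finite_measure_subalgebra M "sigma_rv M X (C \<union> B)"
    by (rule finite_measure_subalgebraI[OF subalgebra_sigma_rv])
  have EM [measurable]: "E \<in> sets M" using E by (rule sigma_rv_sets_M)
  have inth: "integrable M ?h"
    by (rule C.real_cond_exp_int) (rule integrable_indicator_event[OF EM])
  show ?thesis
  proof (rule CB.real_cond_exp_charact_generator[where G = ?G])
    show "?G \<subseteq> Pow (space M)"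
      using sets.sets_into_space[of _ ?C] by fastforce
    show "space M \<in> ?G"
      using sets.top[of ?C] sets.top[of "sigma_rv M X B"] by (fastforce simp del: sets.top)
    have "subalgebra (sigma_rv M X (C \<union> B)) ?C"
      using sets_sigma_rv_mono[of C "C \<union> B" M X] by (auto simp: subalgebra_def)
    then show "?h \<in> borel_measurable (sigma_rv M X (C \<union> B))"
      by (rule measurable_from_subalg) simp
    fix W assume "W \<in> ?G"
    then obtain c b where W: "W = c \<inter> b" and c [measurable]: "c \<in> sets ?C"
      and b: "b \<in> sets (sigma_rv M X B)" by auto
    have [measurable]: "c \<in> sets M" "b \<in> sets M"
      by (fact sigma_rv_sets_M[OF c], fact sigma_rv_sets_M[OF b])
    have AE: "AE x in M. ?h x * real_cond_exp M ?C (indicator b) x =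
        real_cond_exp M ?C (indicator (E \<inter> b)) x"
      using ci E b by (auto simp: cond_indep_def)
    have "(\<integral>x\<in>W. ?h x \<partial>M) = (\<integral>x. (indicator c x * ?h x) * indicator b x \<partial>M)"
      by (auto simp: set_lebesgue_integral_def W indicator_inter_arith intro!: Bochner_Integration.integral_cong)
    \<comment> \<open>The factor \<open>indicator c x * ?h x\<close> is measurable for
      \<open>?C\<close>, so the indicator of \<open>b\<close> may be replaced by its conditional
      expectation. Two steps below the same rule is used backwards for
      \<open>E \<inter> b\<close>.\<close>
    also have "\<dots> = (\<integral>x. (indicator c x * ?h x) * real_cond_exp M ?C (indicator b) x \<partial>M)"
    proof (rule C.real_cond_exp_intg(2)[symmetric])
      have "integrable M (\<lambda>x. indicator (c \<inter> b) x * ?h x)"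
        by (rule integrable_indicator_times[OF _ inth]) simp
      then show "integrable M (\<lambda>x. (indicator c x * ?h x) * indicator b x)"
        by (simp add: indicator_inter_arith mult_ac)
    qed auto
    also have "\<dots> = (\<integral>x. indicator c x * real_cond_exp M ?C (indicator (E \<inter> b)) x \<partial>M)"
      using AE by (intro integral_cong_AE) (auto simp: mult.assoc)
    also have "\<dots> = (\<integral>x. indicator c x * indicator (E \<inter> b) x \<partial>M)"
    proof (rule C.real_cond_exp_intg(2))
      show "integrable M (\<lambda>x. indicator c x * indicator (E \<inter> b) x :: real)"
        by (intro integrable_indicator_times integrable_indicator_event) auto
    qed auto
    also have "\<dots> = (\<integral>x\<in>W. indicator E x \<partial>M)"
      by (auto simp: set_lebesgue_integral_def W indicator_inter_arith intro!: Bochner_Integration.integral_cong)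
    finally show "(\<integral>x\<in>W. indicator E x \<partial>M) = (\<integral>x\<in>W. ?h x \<partial>M)" by simp
  qed (simp_all add: sets_sigma_rv_Un Int_stable_sigma_rv_Int inth integrable_indicator_event)
qed

text \<open>Converse of \<open>cond_exp_eq_of_cond_indep\<close>. Condition first on the larger
  sigma-algebra, where the indicator of b can be pulled out and P(E | X_C, X_B) replaced by P(E |
  X_C); then condition on X_C, where P(E | X_C) can be pulled out.\<close>

lemma cond_indep_of_cond_exp_eq:
  assumes eq: "\<And>E. E \<in> sets (sigma_rv M X A) \<Longrightarrow>
      AE x in M. real_cond_exp M (sigma_rv M X (C \<union> B)) (indicator E) x =
                 real_cond_exp M (sigma_rv M X C) (indicator E) x"
  shows "cond_indep M X A B C"
  unfolding cond_indep_def
proof (intro ballI)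
  let ?C = "sigma_rv M X C" and ?CB = "sigma_rv M X (C \<union> B)"
  fix E b assume E: "E \<in> sets (sigma_rv M X A)" and b: "b \<in> sets (sigma_rv M X B)"
  let ?h = "real_cond_exp M ?C (indicator E)"
  interpret C: finite_measure_subalgebra M ?C
    by (rule finite_measure_subalgebraI[OF subalgebra_sigma_rv])
  interpret CB: finite_measure_subalgebra M ?CB
    by (rule finite_measure_subalgebraI[OF subalgebra_sigma_rv])
  have [measurable]: "E \<in> sets M" "b \<in> sets M" using E b by (auto intro: sigma_rv_sets_M)
  have bCB [measurable]: "b \<in> sets ?CB"
    using b sets_sigma_rv_mono[of B "C \<union> B" M X] by auto
  have sub: "subalgebra ?CB ?C"
    using sets_sigma_rv_mono[of C "C \<union> B" M X] by (auto simp: subalgebra_def)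
  have inth: "integrable M ?h"
    by (intro C.real_cond_exp_int integrable_indicator_event) simp
  have intbh: "integrable M (\<lambda>x. ?h x * indicator b x)"
    using integrable_indicator_times[OF _ inth, of b] by (simp add: mult.commute)
  have intEb: "integrable M (\<lambda>x. indicator b x * indicator E x :: real)"
    by (intro integrable_indicator_times integrable_indicator_event) auto
  have 1: "AE x in M. real_cond_exp M ?CB (indicator (E \<inter> b)) x = ?h x * indicator b x"
  proof -
    have "AE x in M. real_cond_exp M ?CB (\<lambda>x. indicator b x * indicator E x) x =
        indicator b x * real_cond_exp M ?CB (indicator E) x"
      using intEb by (intro CB.real_cond_exp_mult) auto
    moreover have "(\<lambda>x. indicator b x * indicator E x :: real) = indicator (E \<inter> b)"
      by (auto simp: indicator_def)
    ultimately show ?thesis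
      using eq[OF E] by (auto simp: mult.commute)
  qed
  have "AE x in M. real_cond_exp M ?C (real_cond_exp M ?CB (indicator (E \<inter> b))) x =
      real_cond_exp M ?C (indicator (E \<inter> b)) x"
    by (intro C.real_cond_exp_nested_subalg sub subalgebra_sigma_rv integrable_indicator_event) simp
  moreover have "AE x in M. real_cond_exp M ?C (real_cond_exp M ?CB (indicator (E \<inter> b))) x =
      real_cond_exp M ?C (\<lambda>x. ?h x * indicator b x) x"
    using 1 by (intro C.real_cond_exp_cong) auto
  moreover have "AE x in M. real_cond_exp M ?C (\<lambda>x. ?h x * indicator b x) x =
      ?h x * real_cond_exp M ?C (indicator b) x"
    using intbh by (intro C.real_cond_exp_mult) auto
  ultimately show "AE x in M. ?h x * real_cond_exp M ?C (indicator b) x =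
      real_cond_exp M ?C (indicator (E \<inter> b)) x"
    by eventually_elim simp
qed

text \<open>In terms of conditional expectations, P(E | X_C) has to integrate like the indicator of
  E over a generator of the sigma-algebra of \<open>C \<union> B\<close>. The events that involve
  only finitely many indices from \<open>B\<close> form such a generator, and on each of them the
  finite case applies.\<close>

lemma cond_indep_finite_parts:
  assumes fin: "\<And>B'. finite B' \<Longrightarrow> B' \<subseteq> B \<Longrightarrow> cond_indep M X A B' C"
  shows "cond_indep M X A B C"
proof (rule cond_indep_of_cond_exp_eq)
  fix E assume E: "E \<in> sets (sigma_rv M X A)"
  let ?C = "sigma_rv M X C" and ?CB = "sigma_rv M X (C \<union> B)"
  let ?h = "real_cond_exp M ?C (indicator E)"
  let ?G = "\<Union>B'\<in>{B'. finite B' \<and> B' \<subseteq> B}. sets (sigma_rv M X (C \<union> B'))"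
  interpret C: finite_measure_subalgebra M ?C
    by (rule finite_measure_subalgebraI[OF subalgebra_sigma_rv])
  interpret CB: finite_measure_subalgebra M ?CB
    by (rule finite_measure_subalgebraI[OF subalgebra_sigma_rv])
  have EM [measurable]: "E \<in> sets M" using E by (rule sigma_rv_sets_M)
  have inth: "integrable M ?h"
    by (intro C.real_cond_exp_int integrable_indicator_event EM)
  show "AE x in M. real_cond_exp M ?CB (indicator E) x = ?h x"
  proof (rule CB.real_cond_exp_charact_generator[OF sets_sigma_rv_finite_parts])
    show "Int_stable ?G"
    proof (rule Int_stableI)
      \<comment> \<open>The union is directed: both events already belong to the sigma-algebra for
        \<open>B1 \<union> B2\<close>.\<close>
      fix a b assume "a \<in> ?G" "b \<in> ?G"
      then obtain B1 B2 where "finite B1" "B1 \<subseteq> B" "a \<in> sets (sigma_rv M X (C \<union> B1))"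
        "finite B2" "B2 \<subseteq> B" "b \<in> sets (sigma_rv M X (C \<union> B2))" by auto
      moreover from this have "a \<in> sets (sigma_rv M X (C \<union> (B1 \<union> B2)))"
          "b \<in> sets (sigma_rv M X (C \<union> (B1 \<union> B2)))"
        using sets_sigma_rv_mono[of "C \<union> B1" "C \<union> (B1 \<union> B2)" M X]
          sets_sigma_rv_mono[of "C \<union> B2" "C \<union> (B1 \<union> B2)" M X] by auto
      ultimately show "a \<inter> b \<in> ?G"
        by (intro UN_I[of "B1 \<union> B2"]) auto
    qed
    show "?G \<subseteq> Pow (space M)"
      using sets.sets_into_space[of _ "sigma_rv M X _"] by fastforce
    show "space M \<in> ?G"
      using sets.top[of "sigma_rv M X (C \<union> {})"] by (intro UN_I[of "{}"]) auto
    have "subalgebra ?CB ?C"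
      using sets_sigma_rv_mono[of C "C \<union> B" M X] by (auto simp: subalgebra_def)
    then show "?h \<in> borel_measurable ?CB"
      by (rule measurable_from_subalg) simp
    fix W assume "W \<in> ?G"
    then obtain B' where B': "finite B'" "B' \<subseteq> B" and W: "W \<in> sets (sigma_rv M X (C \<union> B'))"
      by auto
    interpret CB': finite_measure_subalgebra M "sigma_rv M X (C \<union> B')"
      by (rule finite_measure_subalgebraI[OF subalgebra_sigma_rv])
    have [measurable]: "W \<in> sets M" using W by (rule sigma_rv_sets_M)
    have "(\<integral>x\<in>W. indicator E x \<partial>M) =
        (\<integral>x\<in>W. real_cond_exp M (sigma_rv M X (C \<union> B')) (indicator E) x \<partial>M)"
      by (rule CB'.real_cond_exp_intA[OF integrable_indicator_event[OF EM] W])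
    also have "\<dots> = (\<integral>x\<in>W. ?h x \<partial>M)"
      unfolding set_lebesgue_integral_def
      using cond_exp_eq_of_cond_indep[OF fin[OF B'] E] by (intro integral_cong_AE) auto
    finally show "(\<integral>x\<in>W. indicator E x \<partial>M) = (\<integral>x\<in>W. ?h x \<partial>M)" .
  qed (simp_all add: inth integrable_indicator_event)
qed

section \<open>Dropping finitely many blocks by (IIP) and passing to the tail by (DCP)\<close>

lemma IIP_finite_blocks:
  assumes iip: "IIP M X" and Y: "finite Y" and disj: "A \<inter> Y = {}" "A \<inter> Z = {}" "Y \<inter> Z = {}"
    and P: "partition_on A P" and fin: "\<And>S. S \<in> P \<Longrightarrow> finite S"
    and ci: "\<And>S. S \<in> P \<Longrightarrow> cond_indep M X Y S (Z \<union> \<Union>(P - {S}))"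
    and Q: "finite Q" "Q \<subseteq> P"
  shows "cond_indep M X Y (\<Union>Q) (Z \<union> \<Union>(P - Q))"
  using Q
proof (induction Q rule: finite_induct)
  case empty
  show ?case by (rule cond_indep_of_cond_exp_eq) simp
next
  case (insert S Q)
  let ?D = "Z \<union> \<Union>(P - insert S Q)"
  have SP: "S \<in> P" and QP: "Q \<subseteq> P" using insert by auto
  have PA: "\<Union>P = A" using partition_onD1[OF P] by simp
  have pd: "T \<inter> T' = {}" if "T \<in> P" "T' \<in> P" "T \<noteq> T'" for T T'
    using partition_onD2[OF P] that by (auto simp: disjoint_def)
  \<comment> \<open>Relative to the smaller conditioning set \<open>?D\<close>, the induction
    hypothesis has \<open>S\<close> as additional conditioning, and the assumption on
    \<open>S\<close> has \<open>\<Union>Q\<close>. These are the two premises of (IIP) for the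
    finite sets \<open>Y\<close>, \<open>\<Union>Q\<close> and \<open>S\<close>; the possibly
    infinite rest sits in \<open>?D\<close>.\<close>
  have e1: "Z \<union> \<Union>(P - Q) = S \<union> ?D"
    using SP insert.hyps(2) by auto
  have e2: "Z \<union> \<Union>(P - {S}) = \<Union>Q \<union> ?D"
    using QP insert.hyps(2) by auto
  have "cond_indep M X Y (\<Union>Q) (S \<union> ?D)" using insert.IH[OF QP] by (simp only: e1)
  moreover have "cond_indep M X Y S (\<Union>Q \<union> ?D)" using ci[OF SP] by (simp only: e2)
  moreover have "finite (\<Union>Q)" using insert.hyps(1) QP fin by auto
  moreover have "\<Union>Q \<inter> S = {}" using pd[OF _ SP] QP insert.hyps(2) by blast
  moreover have "S \<inter> ?D = {}"
    using pd[OF SP] disj(2) PA SP by blast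
  moreover have "\<Union>Q \<inter> ?D = {}"
    using pd disj(2) PA QP by blast
  moreover have "Y \<inter> ?D = {}" "Y \<inter> S = {}" "Y \<inter> \<Union>Q = {}"
    using disj PA SP QP by blast+
  ultimately have "cond_indep M X Y (\<Union>Q \<union> S) ?D"
    using iip[unfolded IIP_def, rule_format, of Y "\<Union>Q" S ?D] Y fin[OF SP] by blast
  then show ?case by (simp add: Un_commute)
qed

text \<open>The conditional expectation given \<open>V\<close> has a version measurable for the
  intersection of the sigma-algebras of \<open>Z \<union> {n..}\<close>. By (DCP) every event of
  that intersection agrees with one of the sigma-algebra of \<open>Z\<close> up to a null set, so
  this version cannot carry more information than \<open>Z\<close>.\<close>

lemma DCP_cond_exp_eq:
  assumes dcp: "DCP M X" and ZV: "Z \<subseteq> V" and D: "\<And>n. D n \<subseteq> Z \<union> {n..}"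
    and u: "integrable M u"
    and eq: "\<And>n. AE x in M. real_cond_exp M (sigma_rv M X V) u x =
                              real_cond_exp M (sigma_rv M X (D n)) u x"
  shows "AE x in M. real_cond_exp M (sigma_rv M X V) u x = real_cond_exp M (sigma_rv M X Z) u x"
proof -
  let ?f = "real_cond_exp M (sigma_rv M X V) u" and ?h = "real_cond_exp M (sigma_rv M X Z) u"
  let ?I = "\<Inter>n. sets (sigma_rv M X (Z \<union> {n..}))"
  \<comment> \<open>Each conditional expectation given \<open>D n\<close> is measurable only for
    tails up to its own index. Their pointwise limit is one function that is measurable for all
    tails at once.\<close>
  let ?l = "\<lambda>x. lim (\<lambda>n. real_cond_exp M (sigma_rv M X (D n)) u x)"
  define T where "T = sigma (space M) ?I"
  have Pow: "?I \<subseteq> Pow (space M)"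
    using sets.space_closed[of "sigma_rv M X (Z \<union> {0..})"] by (simp only: space_sigma_rv) blast
  then have spT: "space T = space M"
    unfolding T_def by (rule space_measure_of)
  have "sigma_sets (space M) ?I \<subseteq> sets (sigma_rv M X (Z \<union> {n..}))" for n
    using sets.sigma_sets_subset[of ?I "sigma_rv M X (Z \<union> {n..})"] by (simp only: space_sigma_rv) blast
  then have "sigma_sets (space M) ?I = ?I"
    by blast
  then have setsT: "sets T = ?I"
    unfolding T_def using sets_measure_of[OF Pow] by simp
  have subT: "subalgebra M T"
    using spT setsT by (auto simp: subalgebra_def intro: sigma_rv_sets_M)
  interpret T: finite_measure_subalgebra M T by (rule finite_measure_subalgebraI[OF subT])
  interpret V: finite_measure_subalgebra M "sigma_rv M X V"
    by (rule finite_measure_subalgebraI[OF subalgebra_sigma_rv])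
  interpret Z: finite_measure_subalgebra M "sigma_rv M X Z"
    by (rule finite_measure_subalgebraI[OF subalgebra_sigma_rv])
  have lk: "?l \<in> borel_measurable (sigma_rv M X (Z \<union> {k..}))" for k
  proof (rule borel_measurable_lim_tail[where k = k])
    fix n assume "k \<le> n"
    then have "D n \<subseteq> Z \<union> {k..}" using D[of n] by fastforce
    then have "subalgebra (sigma_rv M X (Z \<union> {k..})) (sigma_rv M X (D n))"
      using sets_sigma_rv_mono[of "D n" "Z \<union> {k..}" M X] by (auto simp: subalgebra_def)
    then show "real_cond_exp M (sigma_rv M X (D n)) u \<in> borel_measurable (sigma_rv M X (Z \<union> {k..}))"
      by (rule measurable_from_subalg) simp
  qed
  have lT: "?l \<in> borel_measurable T"
    using lk by (auto simp: measurable_def spT setsT)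
  have hT: "?h \<in> borel_measurable T"
  proof -
    have "subalgebra T (sigma_rv M X Z)"
      using sets_sigma_rv_mono[of Z "Z \<union> {_..}" M X] by (auto simp: subalgebra_def spT setsT)
    then show ?thesis by (rule measurable_from_subalg) simp
  qed
  have lM [measurable]: "?l \<in> borel_measurable M"
    by (rule measurable_from_subalg[OF subT lT])
  \<comment> \<open>Outside a common null set the sequence is constant with value
    \<open>?f x\<close>, and so is its limit.\<close>
  have "AE x in M. \<forall>n. ?f x = real_cond_exp M (sigma_rv M X (D n)) u x"
    using eq by (simp add: AE_all_countable)
  then have lf: "AE x in M. ?l x = ?f x"
    by eventually_elim (metis (no_types, lifting) limI tendsto_const ext)
  have intf: "integrable M ?f" using u by (rule V.real_cond_exp_int)
  have intl: "integrable M ?l"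
    using intf lf by (subst integrable_cong_AE[where g = ?f]) auto
  have inth: "integrable M ?h" using u by (rule Z.real_cond_exp_int)
  have "AE x in M. real_cond_exp M T ?l x = ?h x"
  proof (rule T.real_cond_exp_charact[OF _ intl inth hT])
    fix E assume "E \<in> sets T"
    then have EI: "E \<in> ?I" by (simp add: setsT)
    then obtain E' where E': "E' \<in> sets (sigma_rv M X Z)" and null: "measure M (sym_diff E E') = 0"
      using dcp unfolding DCP_def by blast
    have [measurable]: "E \<in> sets M" "E' \<in> sets M"
      using EI E' by (auto intro: sigma_rv_sets_M)
    have null': "sym_diff E E' \<in> null_sets M"
      using null by (auto simp: null_sets_def emeasure_eq_measure)
    have E'V: "E' \<in> sets (sigma_rv M X V)"
      using E' sets_sigma_rv_mono[OF ZV] by blast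
    \<comment> \<open>After replacing \<open>E\<close> by \<open>E'\<close>, the event lies in the
      sigma-algebras of both \<open>V\<close> and \<open>Z\<close>. Hence \<open>?f\<close> and
      \<open>?h\<close> both integrate over it to the integral of \<open>u\<close>.\<close>
    have "(\<integral>x\<in>E. ?l x \<partial>M) = (\<integral>x\<in>E. ?f x \<partial>M)"
      unfolding set_lebesgue_integral_def using lf by (intro integral_cong_AE) auto
    also have "\<dots> = (\<integral>x\<in>E'. ?f x \<partial>M)"
      using null' by (intro set_integral_null_delta intf) auto
    also have "\<dots> = (\<integral>x\<in>E'. u x \<partial>M)"
      by (rule V.real_cond_exp_intA[OF u E'V, symmetric])
    also have "\<dots> = (\<integral>x\<in>E'. ?h x \<partial>M)"
      by (rule Z.real_cond_exp_intA[OF u E'])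
    also have "\<dots> = (\<integral>x\<in>E. ?h x \<partial>M)"
      using null' by (intro set_integral_null_delta[symmetric] inth) auto
    finally show "(\<integral>x\<in>E. ?l x \<partial>M) = (\<integral>x\<in>E. ?h x \<partial>M)" .
  qed
  \<comment> \<open>Being measurable for \<open>T\<close>, the limit is its own conditional
    expectation, and it was just seen to have \<open>?h\<close> as conditional expectation.\<close>
  moreover have "AE x in M. real_cond_exp M T ?l x = ?l x"
    by (rule T.real_cond_exp_F_meas[OF intl lT])
  ultimately show ?thesis
    using lf by eventually_elim simp
qed

lemma P5star_finite_right:
  assumes iip: "IIP M X" and dcp: "DCP M X"
    and Y: "finite Y" and disj: "A \<inter> Y = {}" "A \<inter> Z = {}" "Y \<inter> Z = {}"
    and P: "partition_on A P" and fin: "\<And>S. S \<in> P \<Longrightarrow> finite S"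
    and ci: "\<And>S. S \<in> P \<Longrightarrow> cond_indep M X S Y (Z \<union> \<Union>(P - {S}))"
  shows "cond_indep M X A Y Z"
proof (rule cond_indep_sym, rule cond_indep_of_cond_exp_eq)
  fix E assume E: "E \<in> sets (sigma_rv M X Y)"
  \<comment> \<open>Removing all blocks that meet the numbers below n, instead of the first n blocks
    of an enumeration, forces the remaining blocks into \<open>{n..}\<close>. Finite and infinite
    partitions are treated alike.\<close>
  define Q where "Q n = {S \<in> P. S \<inter> {..<n} \<noteq> {}}" for n :: nat
  have Q: "finite (Q n)" "Q n \<subseteq> P" for n
    unfolding Q_def using finite_blocks_meeting_finite_set[OF P] by auto
  have PA: "\<Union>P = A" using partition_onD1[OF P] by simp
  show "AE x in M. real_cond_exp M (sigma_rv M X (Z \<union> A)) (indicator E) x =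
      real_cond_exp M (sigma_rv M X Z) (indicator E) x"
  proof (rule DCP_cond_exp_eq[OF dcp, where D = "\<lambda>n. Z \<union> \<Union>(P - Q n)"])
    show "Z \<subseteq> Z \<union> A" by simp
    show "integrable M (indicator E :: 'a \<Rightarrow> real)"
      by (rule integrable_indicator_event[OF sigma_rv_sets_M[OF E]])
    fix n
    have "k \<ge> n" if "k \<in> S" "S \<in> P - Q n" for k S
      using that unfolding Q_def by (cases "k < n") auto
    then show "Z \<union> \<Union>(P - Q n) \<subseteq> Z \<union> {n..}" by blast
    have "cond_indep M X Y (\<Union>(Q n)) (Z \<union> \<Union>(P - Q n))"
      by (rule IIP_finite_blocks[OF iip Y disj P fin cond_indep_sym[OF ci] Q])
    then have "AE x in M. real_cond_exp M (sigma_rv M X (Z \<union> \<Union>(P - Q n) \<union> \<Union>(Q n))) (indicator E) x =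
        real_cond_exp M (sigma_rv M X (Z \<union> \<Union>(P - Q n))) (indicator E) x"
      using E by (rule cond_exp_eq_of_cond_indep)
    \<comment> \<open>Restoring the dropped blocks gives the same set for every n, so all the
      conditional expectations are compared with a single one.\<close>
    moreover have "Z \<union> \<Union>(P - Q n) \<union> \<Union>(Q n) = Z \<union> A"
      using Q(2)[of n] PA by blast
    ultimately show "AE x in M. real_cond_exp M (sigma_rv M X (Z \<union> A)) (indicator E) x =
        real_cond_exp M (sigma_rv M X (Z \<union> \<Union>(P - Q n))) (indicator E) x"
      by (simp only:)
  qed
qed

end

theorem theorem5p7:
  fixes M :: "'a measure" and X :: "nat \<Rightarrow> 'a \<Rightarrow> real"
  assumes "prob_space M"
    and "\<And>n. X n \<in> borel_measurable M"
    and "IIP M X"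
    and "DCP M X"
  shows "P5star (cond_indep M X)"
proof -
  interpret prob_space M by fact
  interpret real_rv_family M X by unfold_locales (rule assms(2))
  show ?thesis
    unfolding P5star_def
  proof (intro allI impI, elim conjE)
    fix A Y Z P
    assume *: "A \<inter> Y = {}" "A \<inter> Z = {}" "Y \<inter> Z = {}" "partition_on A P"
      "\<forall>S\<in>P. finite S" "\<forall>S\<in>P. cond_indep M X S Y (Z \<union> \<Union>(P - {S}))"
    show "cond_indep M X A Y Z"
    \<comment> \<open>(IIP) speaks of finite sets only, so \<open>Y\<close> is replaced by its
      finite subsets; the assumptions on the blocks pass to these by monotonicity.\<close>
    proof (rule cond_indep_finite_parts)
      fix Y' assume Y': "finite Y'" "Y' \<subseteq> Y"
      have disj: "A \<inter> Y' = {}" "Y' \<inter> Z = {}" using *(1,3) Y'(2) by auto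
      have fin: "finite S" if "S \<in> P" for S using *(5) that by blast
      have ci: "cond_indep M X S Y' (Z \<union> \<Union>(P - {S}))" if "S \<in> P" for S
        using *(6)[rule_format, OF that] Y'(2) by (rule cond_indep_subset)
      show "cond_indep M X A Y' Z"
        by (rule P5star_finite_right[OF assms(3,4) Y'(1) disj(1) *(2) disj(2) *(4) fin ci])
    qed
  qed
qed

end
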